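(* Let $(X,d)$ be a complete $b$-metric space and let $f:X\to X$ be a convex contraction, i.e. a continuous function for which there exist $a,b\in(0,1)$ such that $a+b<1$ and $$d(f^{[2]}(x),f^{[2]}(y))\le a\,d(f(x),f(y))+b\,d(x,y)$$ for all $x,y\in X$. Then $f$ is a Picard operator.
   Context: Given a nonempty set $X$ and a real number $s\in[1,\infty)$, a function $d:X\times X\to[0,\infty)$ is a $b$-metric (with constant $s$) if for all $x,y,z\in X$: (i) $d(x,y)=0$ if and only if $x=y$; (ii) $d(x,y)=d(y,x)$; (iii) $d(x,y)\le s(d(x,z)+d(z,y))$. The pair $(X,d)$ is then called a $b$-metric space (with constant $s$). The function $d$ is not assumed to be continuous. A sequence $(x_n)$ in $X$ is convergent if there is $l\in X$ with $\lim_{n\to\infty}d(x_n,l)=0$ (then $(x_n)$ converges to $l$); it is Cauchy if for every $\varepsilon>0$ there is $n_\varepsilon$ with $d(x_m,x_n)<\varepsilon$ for all $m,n\ge n_\varepsilon$. The space $(X,d)$ is complete if every Cauchy sequence is convergent. $X$ is endowed with the topology induced by this convergence; continuity of $f:X\to X$ amounts to: $d(x_n,x)\to 0$ implies $d(f(x_n),f(x))\to 0$. For $f:X\to X$ and $n\in\mathbb{N}$, $f^{[n]}$ denotes the $n$-fold composition of $f$ with itself ($f^{[0]}=\mathrm{id}$). A function $f:X\to X$ is a Picard operator if there is a unique fixed point $\alpha$ of $f$ and, for every $x\in X$, the sequence $(f^{[n]}(x))_{n\in\mathbb{N}}$ converges to $\alpha$. *)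

theory Defs
  imports Complex_Main "HOL-Library.FuncSet"
begin

text \<open>
  The space is a carrier set \<open>X\<close>; the values of \<open>d\<close> and \<open>f\<close> outside \<open>X\<close> are
  irrelevant. As \<open>d\<close> is not assumed to be continuous and the triangle inequality is relaxed by
  the factor \<open>s\<close>, the library's metric spaces do not apply.
\<close>

locale b_metric_space =
  fixes X :: "'a set" and d :: "'a \<Rightarrow> 'a \<Rightarrow> real" and s :: real
  assumes nonempty: "X \<noteq> {}"
    and const_ge_1: "s \<ge> 1"
    and nonneg: "\<lbrakk>x \<in> X; y \<in> X\<rbrakk> \<Longrightarrow> 0 \<le> d x y"
    and zero_iff: "\<lbrakk>x \<in> X; y \<in> X\<rbrakk> \<Longrightarrow> d x y = 0 \<longleftrightarrow> x = y"
    and commute: "\<lbrakk>x \<in> X; y \<in> X\<rbrakk> \<Longrightarrow> d x y = d y x"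
    and triangle: "\<lbrakk>x \<in> X; y \<in> X; z \<in> X\<rbrakk> \<Longrightarrow> d x y \<le> s * (d x z + d z y)"

definition converges_to :: "('a \<Rightarrow> 'a \<Rightarrow> real) \<Rightarrow> (nat \<Rightarrow> 'a) \<Rightarrow> 'a \<Rightarrow> bool" where
  "converges_to d u l \<longleftrightarrow> (\<lambda>n. d (u n) l) \<longlonglongrightarrow> 0"

definition cauchy_seq :: "('a \<Rightarrow> 'a \<Rightarrow> real) \<Rightarrow> (nat \<Rightarrow> 'a) \<Rightarrow> bool" where
  "cauchy_seq d u \<longleftrightarrow> (\<forall>\<epsilon>>0. \<exists>N. \<forall>m\<ge>N. \<forall>n\<ge>N. d (u m) (u n) < \<epsilon>)"

definition complete_b_metric :: "'a set \<Rightarrow> ('a \<Rightarrow> 'a \<Rightarrow> real) \<Rightarrow> bool" where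
  "complete_b_metric X d \<longleftrightarrow>
     (\<forall>u. range u \<subseteq> X \<longrightarrow> cauchy_seq d u \<longrightarrow> (\<exists>l\<in>X. converges_to d u l))"

text \<open>
  Continuity with respect to the topology induced by convergence, which amounts to sequential
  continuity.
\<close>

definition b_continuous :: "'a set \<Rightarrow> ('a \<Rightarrow> 'a \<Rightarrow> real) \<Rightarrow> ('a \<Rightarrow> 'a) \<Rightarrow> bool" where
  "b_continuous X d f \<longleftrightarrow>
     (\<forall>u. \<forall>x\<in>X. range u \<subseteq> X \<longrightarrow> converges_to d u x \<longrightarrow> converges_to d (\<lambda>n. f (u n)) (f x))"

definition convex_contraction :: "'a set \<Rightarrow> ('a \<Rightarrow> 'a \<Rightarrow> real) \<Rightarrow> ('a \<Rightarrow> 'a) \<Rightarrow> bool" where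
  "convex_contraction X d f \<longleftrightarrow>
     f \<in> X \<rightarrow> X \<and> b_continuous X d f \<and>
     (\<exists>a\<in>{0<..<1}. \<exists>b\<in>{0<..<1}. a + b < 1 \<and>
        (\<forall>x\<in>X. \<forall>y\<in>X. d ((f ^^ 2) x) ((f ^^ 2) y) \<le> a * d (f x) (f y) + b * d x y))"

definition picard_operator :: "'a set \<Rightarrow> ('a \<Rightarrow> 'a \<Rightarrow> real) \<Rightarrow> ('a \<Rightarrow> 'a) \<Rightarrow> bool" where
  "picard_operator X d f \<longleftrightarrow>
     f \<in> X \<rightarrow> X \<and>
     (\<exists>\<alpha>\<in>X. f \<alpha> = \<alpha> \<and> (\<forall>\<beta>\<in>X. f \<beta> = \<beta> \<longrightarrow> \<beta> = \<alpha>) \<and>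
        (\<forall>x\<in>X. converges_to d (\<lambda>n. (f ^^ n) x) \<alpha>))"

end

theory Submission
  imports Defs
begin

text \<open>
  With \<open>r = sqrt (a + b)\<close> one has \<open>a r + b \<le> r\<^sup>2\<close>, so
  \<open>d (f\<^sup>n x) (f\<^sup>n y) \<le> r\<^sup>n (d x y + d (f x) (f y) / r)\<close>
  by two-step induction. Hence any two orbits approach each other, and an orbit is Cauchy as soon
  as it is bounded. Iterating the relaxed triangle inequality along an orbit would accumulate
  powers of \<open>s\<close>; instead one triangle inequality through \<open>f\<^sup>k x\<close>, with \<open>k\<close> so large that
  \<open>s r\<^sup>k (1 + s / r) \<le> 1/2\<close>, bounds the orbit. By continuity the limit is a fixed point.
\<close>

text \<open>The hypothesis on \<open>r\<close> makes \<open>K * r ^ n\<close> a supersolution of the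
  recurrence. The induction has to carry two consecutive terms, which is why \<open>K\<close> is
  tested against both \<open>D 0\<close> and \<open>D 1\<close>.\<close>

lemma two_step_geometric_bound:
  fixes D :: "nat \<Rightarrow> real"
  assumes step: "\<And>n. D (n + 2) \<le> a * D (n + 1) + b * D n"
    and nonneg: "0 \<le> a" "0 \<le> b" "0 < r"
    and r: "a * r + b \<le> r\<^sup>2"
    and K: "D 0 \<le> K" "D 1 \<le> K * r" "0 \<le> K"
  shows "D n \<le> K * r ^ n"
proof -
  have "D n \<le> K * r ^ n \<and> D (n + 1) \<le> K * r ^ (n + 1)"
  proof (induction n)
    case 0
    then show ?case using K by simp
  next
    case (Suc n)
    have "D (n + 2) \<le> a * D (n + 1) + b * D n" by (rule step)
    also have "\<dots> \<le> a * (K * r ^ (n + 1)) + b * (K * r ^ n)"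
      using Suc nonneg by (intro add_mono mult_left_mono) auto
    also have "\<dots> = K * r ^ n * (a * r + b)" by (simp add: algebra_simps)
    also have "\<dots> \<le> K * r ^ n * r\<^sup>2"
      using r K nonneg by (intro mult_left_mono) auto
    also have "\<dots> = K * r ^ (n + 2)" by (simp add: power_add power2_eq_square)
    finally show ?case using Suc by simp
  qed
  then show ?thesis ..
qed

lemma funpow_closed: "(f ^^ n) x \<in> X" if "f \<in> X \<rightarrow> X" "x \<in> X"
  using that by (induction n) auto

lemma convex_contraction_geometric_bound:
  assumes "b_metric_space X d s" and "convex_contraction X d f"
  obtains r where "0 < r" "r < 1"
    "\<And>x y n. x \<in> X \<Longrightarrow> y \<in> X \<Longrightarrow>
       d ((f ^^ n) x) ((f ^^ n) y) \<le> (d x y + d (f x) (f y) / r) * r ^ n"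
proof -
  interpret b_metric_space X d s by fact
  from assms(2) obtain a b where ab: "0 < a" "0 < b" "a + b < 1"
    and step: "\<And>x y. x \<in> X \<Longrightarrow> y \<in> X \<Longrightarrow>
      d ((f ^^ 2) x) ((f ^^ 2) y) \<le> a * d (f x) (f y) + b * d x y"
    and f: "f \<in> X \<rightarrow> X"
    unfolding convex_contraction_def by (metis greaterThanLessThan_iff)
  note iter = funpow_closed[OF f]
  define r where "r = sqrt (a + b)"
  have r: "0 < r" "r < 1" "r\<^sup>2 = a + b" using ab by (auto simp: r_def)
  \<comment> \<open>Since \<open>r < 1\<close>, the left side is at most \<open>a + b\<close>, which
    is \<open>r\<^sup>2\<close>.\<close>
  have ar: "a * r + b \<le> r\<^sup>2" using ab r by (simp add: mult_left_le)
  show thesis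
  proof (rule that[OF r(1,2)])
    fix x y n assume xy: "x \<in> X" "y \<in> X"
    have fxy: "f x \<in> X" "f y \<in> X" using xy f by auto
    show "d ((f ^^ n) x) ((f ^^ n) y) \<le> (d x y + d (f x) (f y) / r) * r ^ n"
    \<comment> \<open>Here \<open>K\<close> is \<open>D 0 + D 1 / r\<close>, a simple choice with
      \<open>D 0 \<le> K\<close> and \<open>D 1 \<le> K * r\<close>.\<close>
    proof (rule two_step_geometric_bound[where D = "\<lambda>n. d ((f ^^ n) x) ((f ^^ n) y)"])
      show "d ((f ^^ (m + 2)) x) ((f ^^ (m + 2)) y)
          \<le> a * d ((f ^^ (m + 1)) x) ((f ^^ (m + 1)) y) + b * d ((f ^^ m) x) ((f ^^ m) y)" for m
        using step[OF iter iter, OF xy, of m m] by (simp add: numeral_2_eq_2)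
    qed (use ab r ar nonneg[OF xy] nonneg[OF fxy] in \<open>auto simp: field_simps\<close>)
  qed
qed

context
  fixes X :: "'a set" and d :: "'a \<Rightarrow> 'a \<Rightarrow> real" and s r :: real and f :: "'a \<Rightarrow> 'a"
  assumes bm: "b_metric_space X d s"
    and f: "f \<in> X \<rightarrow> X"
    and r: "0 < r" "r < 1"
    and bound: "\<And>x y n. x \<in> X \<Longrightarrow> y \<in> X \<Longrightarrow>
       d ((f ^^ n) x) ((f ^^ n) y) \<le> (d x y + d (f x) (f y) / r) * r ^ n"
begin

interpretation b_metric_space X d s by (rule bm)

lemmas iter_closed = funpow_closed[OF f]

text \<open>Applied to a fixed point, whose orbit is constant, this yields both its uniqueness and
  the convergence of every orbit to it.\<close>

lemma orbits_merge:
  assumes "x \<in> X" "y \<in> X"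
  shows "(\<lambda>n. d ((f ^^ n) x) ((f ^^ n) y)) \<longlonglongrightarrow> 0"
proof (rule tendsto_sandwich[OF _ _ tendsto_const])
  show "(\<lambda>n. (d x y + d (f x) (f y) / r) * r ^ n) \<longlonglongrightarrow> 0"
    using r by (intro tendsto_mult_right_zero LIMSEQ_realpow_zero) auto
qed (use assms in \<open>auto intro!: always_eventually nonneg iter_closed bound\<close>)

text \<open>This is \<open>bound\<close> for the pair \<open>x\<close>, \<open>(f ^^ p) x\<close>.
  The distance between their images is split once through \<open>x\<close>, so a bound at
  \<open>Suc p\<close> is needed besides the one at \<open>p\<close>. The resulting estimate depends
  on \<open>p\<close> only through \<open>B\<close>: a provisional bound can be fed in during an
  induction, a uniform one afterwards.\<close>

lemma orbit_step_bound:
  assumes x: "x \<in> X" and B: "d x ((f ^^ p) x) \<le> B" "d x ((f ^^ Suc p) x) \<le> B"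
  shows "d ((f ^^ n) x) ((f ^^ (n + p)) x) \<le> (B + s * (d x (f x) + B) / r) * r ^ n"
proof -
  have fx: "f x \<in> X" "f ((f ^^ p) x) \<in> X" using x f iter_closed by auto
  have "d (f x) (f ((f ^^ p) x)) \<le> s * (d (f x) x + d x (f ((f ^^ p) x)))"
    using triangle fx x by blast
  also have "\<dots> \<le> s * (d x (f x) + B)"
    using B const_ge_1 commute[OF x fx(1)] by (intro mult_left_mono add_mono) auto
  finally have "d (f x) (f ((f ^^ p) x)) / r \<le> s * (d x (f x) + B) / r"
    using r by (intro divide_right_mono) auto
  then have "(d x ((f ^^ p) x) + d (f x) (f ((f ^^ p) x)) / r) * r ^ n
      \<le> (B + s * (d x (f x) + B) / r) * r ^ n"
    using B r by (intro mult_right_mono add_mono) auto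
  then show ?thesis
    using bound[OF x iter_closed[OF x], of n p] by (simp add: funpow_add)
qed

lemma orbit_bounded:
  assumes x: "x \<in> X"
  obtains B where "\<And>n. d x ((f ^^ n) x) \<le> B"
proof -
  define D where "D n = d x ((f ^^ n) x)" for n
  have D0: "0 \<le> D n" for n unfolding D_def using x iter_closed nonneg by blast
  have s0: "0 < s" using const_ge_1 by simp
  have "(\<lambda>n. s * (1 + s / r) * r ^ n) \<longlonglongrightarrow> 0"
    using r by (intro tendsto_mult_right_zero LIMSEQ_realpow_zero) auto
  \<comment> \<open>The condition \<open>2 \<le> n\<close> makes both \<open>p\<close> and
    \<open>Suc p\<close> smaller than \<open>k + p\<close>, so that the induction hypothesis below
    covers them.\<close>
  then have "\<forall>\<^sub>F n in sequentially. s * (1 + s / r) * r ^ n < 1/2 \<and> 2 \<le> n"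
    by (intro eventually_conj order_tendstoD(2) eventually_ge_at_top) auto
  then obtain k where k: "s * (1 + s / r) * r ^ k < 1/2" "2 \<le> k"
    by (auto simp: eventually_sequentially)
  \<comment> \<open>\<open>C\<close> collects the terms free of \<open>B\<close> in the estimate of
    \<open>D (k + p)\<close> below. The part \<open>2 * C\<close> of \<open>B\<close> gives
    \<open>C + B / 2 \<le> B\<close>, and the sum covers the indices below \<open>k\<close>.\<close>
  define C where "C = s * (D k + s * D 1 / r * r ^ k)"
  define B where "B = 2 * C + (\<Sum>j<k. D j)"
  have C0: "0 \<le> C"
    unfolding C_def using s0 r D0 by (intro mult_nonneg_nonneg add_nonneg_nonneg) auto
  have B0: "0 \<le> B" "2 * C \<le> B"
    unfolding B_def using C0 D0 by (auto intro!: add_nonneg_nonneg sum_nonneg)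
  have "D n \<le> B" for n
  proof (induction n rule: less_induct)
    case (less n)
    show ?case
    proof (cases "n < k")
      case True
      then have "D n \<le> (\<Sum>j<k. D j)" using D0 by (intro member_le_sum) auto
      then show ?thesis using C0 by (simp add: B_def)
    next
      case False
      then obtain p where n: "n = k + p" using le_Suc_ex by (metis not_less)
      have "d x ((f ^^ p) x) \<le> B" "d x ((f ^^ Suc p) x) \<le> B"
        using less[of p] less[of "Suc p"] k n by (auto simp: D_def)
      then have *: "d ((f ^^ k) x) ((f ^^ n) x) \<le> (B + s * (D 1 + B) / r) * r ^ k"
        using orbit_step_bound[OF x] by (simp add: n D_def)
      have "D n \<le> s * (D k + d ((f ^^ k) x) ((f ^^ n) x))"
        unfolding D_def using x iter_closed by (intro triangle) auto
      also have "\<dots> \<le> s * (D k + (B + s * (D 1 + B) / r) * r ^ k)"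
        using * s0 by simp
      also have "\<dots> = C + s * (1 + s / r) * r ^ k * B"
        using r by (simp add: C_def field_simps)
      also have "\<dots> \<le> C + 1/2 * B"
        using k B0 by (intro add_left_mono mult_right_mono) auto
      also have "\<dots> \<le> B" using B0 by simp
      finally show ?thesis .
    qed
  qed
  then show thesis using that unfolding D_def by blast
qed

text \<open>Once the orbit is bounded, the distance between its terms at \<open>m\<close> and
  \<open>n\<close> with \<open>m \<le> n\<close> is at most \<open>K * r ^ m\<close>, whatever the
  gap \<open>n - m\<close>.\<close>

lemma orbit_cauchy:
  assumes x: "x \<in> X"
  shows "cauchy_seq d (\<lambda>n. (f ^^ n) x)"
  unfolding cauchy_seq_def
proof (intro allI impI)
  fix \<epsilon> :: real assume "\<epsilon> > 0"
  obtain B where B: "\<And>n. d x ((f ^^ n) x) \<le> B" using orbit_bounded[OF x] by blast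
  define K where "K = B + s * (d x (f x) + B) / r"
  have "(\<lambda>n. K * r ^ n) \<longlonglongrightarrow> 0"
    using r by (intro tendsto_mult_right_zero LIMSEQ_realpow_zero) auto
  then have "\<forall>\<^sub>F n in sequentially. K * r ^ n < \<epsilon>"
    using \<open>\<epsilon> > 0\<close> by (rule order_tendstoD)
  then obtain N where N: "\<And>n. n \<ge> N \<Longrightarrow> K * r ^ n < \<epsilon>"
    by (auto simp: eventually_sequentially)
  have le: "d ((f ^^ m) x) ((f ^^ n) x) < \<epsilon>" if "N \<le> m" "m \<le> n" for m n
    using orbit_step_bound[OF x B B, of m "n - m"] N[OF that(1)] that(2) by (simp add: K_def)
  have "d ((f ^^ m) x) ((f ^^ n) x) < \<epsilon>" if "N \<le> m" "N \<le> n" for m n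
  proof (cases "m \<le> n")
    case False
    then show ?thesis using le[of n m] that commute iter_closed[OF x] by simp
  qed (use le that in blast)
  then show "\<exists>N. \<forall>m\<ge>N. \<forall>n\<ge>N. d ((f ^^ m) x) ((f ^^ n) x) < \<epsilon>" by blast
qed

end

text \<open>As \<open>d\<close> need not be continuous, limits are not taken inside
  \<open>d\<close>; instead the fixed number \<open>d l m\<close> is bounded by a relaxed triangle
  inequality through \<open>u n\<close>.\<close>

lemma (in b_metric_space) converges_to_unique:
  assumes "range u \<subseteq> X" "l \<in> X" "m \<in> X" "converges_to d u l" "converges_to d u m"
  shows "l = m"
proof -
  have u: "u n \<in> X" for n using assms(1) by auto
  have "(\<lambda>n. s * (d (u n) l + d (u n) m)) \<longlonglongrightarrow> s * (0 + 0)"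
    using assms(4,5) unfolding converges_to_def by (intro tendsto_intros)
  moreover have "d l m \<le> s * (d (u n) l + d (u n) m)" for n
    using triangle[OF assms(2,3) u, of n] commute[OF assms(2) u, of n] by simp
  ultimately have "d l m \<le> s * (0 + 0)" by (intro LIMSEQ_le_const) auto
  then show ?thesis using nonneg zero_iff assms(2,3) by force
qed

theorem corollary3p2:
  fixes X :: "'a set" and d :: "'a \<Rightarrow> 'a \<Rightarrow> real" and s :: real and f :: "'a \<Rightarrow> 'a"
  assumes "b_metric_space X d s"
    and "complete_b_metric X d"
    and "convex_contraction X d f"
  shows "picard_operator X d f"
proof -
  interpret b_metric_space X d s by fact
  have f: "f \<in> X \<rightarrow> X" and cont: "b_continuous X d f"
    using assms(3) by (auto simp: convex_contraction_def)
  obtain r where r: "0 < r" "r < 1"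
    "\<And>x y n. x \<in> X \<Longrightarrow> y \<in> X \<Longrightarrow>
       d ((f ^^ n) x) ((f ^^ n) y) \<le> (d x y + d (f x) (f y) / r) * r ^ n"
    using convex_contraction_geometric_bound[OF assms(1,3)] by blast
  have merge: "(\<lambda>n. d ((f ^^ n) x) ((f ^^ n) y)) \<longlonglongrightarrow> 0" if "x \<in> X" "y \<in> X" for x y
    by (rule orbits_merge[OF assms(1) f r that])
  obtain x where x: "x \<in> X" using nonempty by blast
  define u where "u n = (f ^^ n) x" for n
  have u: "range u \<subseteq> X" using funpow_closed[OF f x] by (auto simp: u_def)
  have "cauchy_seq d u" using orbit_cauchy[OF assms(1) f r x] by (simp add: u_def [abs_def])
  then obtain \<alpha> where \<alpha>: "\<alpha> \<in> X" "converges_to d u \<alpha>"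
    using assms(2) u unfolding complete_b_metric_def by blast
  have "converges_to d (\<lambda>n. f (u n)) (f \<alpha>)"
    using cont \<alpha> u unfolding b_continuous_def by blast
  \<comment> \<open>\<open>f (u n)\<close> is \<open>u (Suc n)\<close>, so this is the shifted
    orbit.\<close>
  moreover have "converges_to d (\<lambda>n. f (u n)) \<alpha>"
    using LIMSEQ_Suc[OF \<alpha>(2)[unfolded converges_to_def]] by (simp add: converges_to_def u_def)
  ultimately have fixp: "f \<alpha> = \<alpha>"
    using converges_to_unique[of "\<lambda>n. f (u n)"] u f \<alpha>(1) by blast
  have iter_fix: "(f ^^ n) \<beta> = \<beta>" if "f \<beta> = \<beta>" for n \<beta>
    using that by (induction n) auto
  have "converges_to d (\<lambda>n. (f ^^ n) y) \<alpha>" if "y \<in> X" for y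
    using merge[OF that \<alpha>(1)] by (simp add: converges_to_def iter_fix[OF fixp])
  \<comment> \<open>Both orbits are constant, so merging says that the constant
    \<open>d \<beta> \<alpha>\<close> tends to 0.\<close>
  moreover have "\<beta> = \<alpha>" if "\<beta> \<in> X" "f \<beta> = \<beta>" for \<beta>
    using merge[OF that(1) \<alpha>(1)] zero_iff[OF that(1) \<alpha>(1)]
    by (simp add: iter_fix[OF fixp] iter_fix[OF that(2)] LIMSEQ_const_iff)
  ultimately show ?thesis
    unfolding picard_operator_def using f \<alpha>(1) fixp by blast
qed

end
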